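(* An ordered abelian group $\langle G;+,0,<\rangle$ has the Archimedean property if and only if it satisfies the principle $\mathtt{CI}_1$.
   Context: $G$ has the Archimedean property if for all $a,b\in G$ with $a>0$ there is $n\in\mathbb{N}$ with $b<n\cdot a$, where $n\cdot a=a+\cdots+a$ ($n$ times). $G$ satisfies $\mathtt{CI}_1$ if for every subset $S\subseteq G$: if (1) there is $a\in G$ with $\{x\in G: x\leqslant a\}\subseteq S$, and (2) there is $\epsilon\in G$, $\epsilon>0$, such that for all $x\in G$, $x\in S$ implies $\{y\in G: x\leqslant y\leqslant x+\epsilon\}\subseteq S$, then $S=G$. *)

theory Defs
  imports Main
begin

text \<open>The ordered abelian group is a type of class \<^class>\<open>linordered_ab_group_add\<close> (so the
  order is total), and properties of the group are predicates on that type. The multiple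
  \<open>n \<cdot> a\<close> is the \<open>n\<close>-fold sum of \<open>a\<close>.\<close>

definition archimedean_property :: "'a::linordered_ab_group_add itself \<Rightarrow> bool" where
  "archimedean_property TYPE('a) \<longleftrightarrow>
     (\<forall>a b :: 'a. a > 0 \<longrightarrow> (\<exists>n::nat. b < (\<Sum>i<n. a)))"

definition CI1 :: "'a::linordered_ab_group_add itself \<Rightarrow> bool" where
  "CI1 TYPE('a) \<longleftrightarrow>
     (\<forall>S :: 'a set.
        (\<exists>a. {x. x \<le> a} \<subseteq> S) \<and>
        (\<exists>\<epsilon>>0. \<forall>x. x \<in> S \<longrightarrow> {y. x \<le> y \<and> y \<le> x + \<epsilon>} \<subseteq> S)
        \<longrightarrow> S = UNIV)"

end

theory Submission
  imports Defs
begin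

text \<open>Both properties say that steps of a fixed positive length eventually pass every element.
  If the group is Archimedean, a set as in \<open>CI1\<close> contains, by induction on n,
  everything up to a plus n times \<epsilon> (\<open>CI1_set_contains_multiples\<close>), and each
  element lies below such a bound. Conversely, for a > 0 the elements below some multiple of a form
  a set that contains everything up to 0 and is closed under steps of length a, so
  \<open>CI1\<close> makes it the whole group.\<close>

lemma CI1_set_contains_multiples:
  fixes a \<epsilon> x :: "'a::linordered_ab_group_add"
  assumes base: "{x. x \<le> a} \<subseteq> S"
    and step: "\<And>x. x \<in> S \<Longrightarrow> {y. x \<le> y \<and> y \<le> x + \<epsilon>} \<subseteq> S"
    and "x \<le> a + (\<Sum>i<n::nat. \<epsilon>)"
  shows "x \<in> S"
  using assms(3)
proof (induction n arbitrary: x)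
  case 0
  then show ?case using base by auto
next
  case (Suc n)
  let ?z = "a + (\<Sum>i<n. \<epsilon>)"
  show ?case
  proof (cases "x \<le> ?z")
    case True
    then show ?thesis by (rule Suc.IH)
  next
    case False
    \<comment> \<open>By totality x lies above \<open>?z\<close>, hence in the step interval that
      starts at \<open>?z\<close>.\<close>
    have "?z \<in> S" by (rule Suc.IH) simp
    moreover have "x \<le> ?z + \<epsilon>" using Suc.prems by (simp add: add.assoc)
    ultimately show ?thesis using step[of ?z] False by auto
  qed
qed

theorem theorem3p8:
  "archimedean_property TYPE('a::linordered_ab_group_add) \<longleftrightarrow> CI1 TYPE('a)"
proof
  assume arch: "archimedean_property TYPE('a)"
  show "CI1 TYPE('a)"
    unfolding CI1_def
  proof (intro allI impI, elim conjE exE)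
    fix S :: "'a set" and a \<epsilon> :: 'a
    assume base: "{x. x \<le> a} \<subseteq> S"
      and pos: "0 < \<epsilon>"
      and step: "\<forall>x. x \<in> S \<longrightarrow> {y. x \<le> y \<and> y \<le> x + \<epsilon>} \<subseteq> S"
    have "x \<in> S" for x
    proof -
      \<comment> \<open>The steps start at a, so the distance to cover is x - a.\<close>
      obtain n :: nat where "x - a < (\<Sum>i<n. \<epsilon>)"
        using arch pos unfolding archimedean_property_def by blast
      then have "x \<le> a + (\<Sum>i<n. \<epsilon>)"
        by (simp add: diff_less_eq add.commute less_imp_le)
      then show ?thesis
        using CI1_set_contains_multiples[OF base] step by blast
    qed
    then show "S = UNIV" by blast
  qed
next
  assume ci: "CI1 TYPE('a)"
  show "archimedean_property TYPE('a)"
    unfolding archimedean_property_def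
  proof (intro allI impI)
    fix a b :: 'a
    assume pos: "0 < a"
    \<comment> \<open>Chosen so that S = UNIV is the Archimedean property for this a.\<close>
    define S where "S = {x. \<exists>n::nat. x < (\<Sum>i<n. a)}"
    have "{x. x \<le> 0} \<subseteq> S"
    proof
      fix x :: 'a
      assume "x \<in> {x. x \<le> 0}"
      \<comment> \<open>One summand is needed: the empty sum is 0, which is not strictly above x =
        0.\<close>
      then have "x < (\<Sum>i<1::nat. a)" using pos by simp
      then show "x \<in> S" unfolding S_def by blast
    qed
    moreover have "{y. x \<le> y \<and> y \<le> x + a} \<subseteq> S" if x: "x \<in> S" for x
    proof
      fix y
      assume "y \<in> {y. x \<le> y \<and> y \<le> x + a}"
      moreover obtain n :: nat where "x < (\<Sum>i<n. a)"
        using x unfolding S_def by blast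
      \<comment> \<open>A step of length a costs one more summand.\<close>
      ultimately have "y < (\<Sum>i<Suc n. a)"
        by (auto intro: le_less_trans)
      then show "y \<in> S" unfolding S_def by blast
    qed
    ultimately have "S = UNIV"
      using ci pos unfolding CI1_def by blast
    then show "\<exists>n::nat. b < (\<Sum>i<n. a)" unfolding S_def by blast
  qed
qed

end
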